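(* Let $G$ be a locally compact étale groupoid, and consider the following two conditions. (1) For every non-empty open $U\subseteq G^{(0)}$ and every compact $K\subseteq G\setminus G^{(0)}$ there exists a non-empty open set $V\subseteq U$ such that $VKV=\emptyset$. (2) The groupoid $G$ is topologically free. Then (1) implies (2). If $G^{(0)}$ is Hausdorff, then (1) and (2) are equivalent.
   Context: The paper works in the Zermelo–Fraenkel axioms ZF, without choice. A groupoid $G$ is a small category in which every morphism has an inverse; $G^{(0)}$ is the set of objects, identified with the identity morphisms (the unit space). The source and range maps $s,r\colon G\to G^{(0)}$ are $s(\gamma)=\gamma^{-1}\gamma$ and $r(\gamma)=\gamma\gamma^{-1}$; a pair $(\alpha,\beta)$ is composable, with product $\alpha\beta$, iff $s(\alpha)=r(\beta)$. A topological groupoid is a groupoid with a topology making multiplication and inversion continuous; $G^{(0)}$ has the subspace topology. $G$ itself is not assumed Hausdorff. A topological groupoid is étale if $r\colon G\to G^{(0)}$ (equivalently $s$) is a local homeomorphism. For subsets $A,B\subseteq G$, $AB=\{\alpha\beta:\alpha\in A,\ \beta\in B,\ s(\alpha)=r(\beta)\}$; in particular, for $V\subseteq G^{(0)}$, $VKV=\{\gamma\in K: r(\gamma)\in V,\ s(\gamma)\in V\}$. $\mathrm{Iso}(G)=\{\gamma\in G: r(\gamma)=s(\gamma)\}$. An étale groupoid $G$ is topologically free if $\mathrm{Int}(\mathrm{Iso}(G)\setminus G^{(0)})=\emptyset$, where $\mathrm{Int}$ is the interior in $G$. *)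

theory Defs
  imports "HOL-Analysis.Analysis"
begin

text \<open>
  Small categories are presented by their morphisms only: an object is identified with its
  identity morphism, so \<open>src\<close> and \<open>rng\<close> take values in \<open>arr\<close>. Products follow the convention
  that \<open>\<alpha>\<beta>\<close> is defined iff \<open>src \<alpha> = rng \<beta>\<close>; the value of \<open>mul\<close> on other pairs is irrelevant.
\<close>

record 'a category_data =
  arr :: "'a set"
  src :: "'a \<Rightarrow> 'a"
  rng :: "'a \<Rightarrow> 'a"
  mul :: "'a \<Rightarrow> 'a \<Rightarrow> 'a"

locale small_category =
  fixes G :: "'a category_data"
  assumes src_closed: "\<gamma> \<in> arr G \<Longrightarrow> src G \<gamma> \<in> arr G"
    and rng_closed: "\<gamma> \<in> arr G \<Longrightarrow> rng G \<gamma> \<in> arr G"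
    and src_src: "\<gamma> \<in> arr G \<Longrightarrow> src G (src G \<gamma>) = src G \<gamma>"
    and rng_src: "\<gamma> \<in> arr G \<Longrightarrow> rng G (src G \<gamma>) = src G \<gamma>"
    and src_rng: "\<gamma> \<in> arr G \<Longrightarrow> src G (rng G \<gamma>) = rng G \<gamma>"
    and rng_rng: "\<gamma> \<in> arr G \<Longrightarrow> rng G (rng G \<gamma>) = rng G \<gamma>"
    and mul_closed: "\<lbrakk>\<alpha> \<in> arr G; \<beta> \<in> arr G; src G \<alpha> = rng G \<beta>\<rbrakk> \<Longrightarrow> mul G \<alpha> \<beta> \<in> arr G"
    and src_mul: "\<lbrakk>\<alpha> \<in> arr G; \<beta> \<in> arr G; src G \<alpha> = rng G \<beta>\<rbrakk> \<Longrightarrow> src G (mul G \<alpha> \<beta>) = src G \<beta>"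
    and rng_mul: "\<lbrakk>\<alpha> \<in> arr G; \<beta> \<in> arr G; src G \<alpha> = rng G \<beta>\<rbrakk> \<Longrightarrow> rng G (mul G \<alpha> \<beta>) = rng G \<alpha>"
    and mul_assoc: "\<lbrakk>\<alpha> \<in> arr G; \<beta> \<in> arr G; \<gamma> \<in> arr G; src G \<alpha> = rng G \<beta>; src G \<beta> = rng G \<gamma>\<rbrakk>
          \<Longrightarrow> mul G (mul G \<alpha> \<beta>) \<gamma> = mul G \<alpha> (mul G \<beta> \<gamma>)"
    and rng_unit: "\<gamma> \<in> arr G \<Longrightarrow> mul G (rng G \<gamma>) \<gamma> = \<gamma>"
    and src_unit: "\<gamma> \<in> arr G \<Longrightarrow> mul G \<gamma> (src G \<gamma>) = \<gamma>"

definition is_inverse :: "'a category_data \<Rightarrow> 'a \<Rightarrow> 'a \<Rightarrow> bool" where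
  "is_inverse G \<gamma> \<delta> \<longleftrightarrow> \<delta> \<in> arr G \<and> src G \<delta> = rng G \<gamma> \<and> rng G \<delta> = src G \<gamma> \<and>
     mul G \<delta> \<gamma> = src G \<gamma> \<and> mul G \<gamma> \<delta> = rng G \<gamma>"

locale groupoid = small_category +
  assumes ex_inverse: "\<gamma> \<in> arr G \<Longrightarrow> \<exists>\<delta>. is_inverse G \<gamma> \<delta>"

definition ginv :: "'a category_data \<Rightarrow> 'a \<Rightarrow> 'a" where
  "ginv G \<gamma> = (THE \<delta>. is_inverse G \<gamma> \<delta>)"

lemma (in groupoid) is_inverse_ginv:
  assumes "\<gamma> \<in> arr G"
  shows "is_inverse G \<gamma> (ginv G \<gamma>)"
proof -
  have "\<exists>!\<delta>. is_inverse G \<gamma> \<delta>"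
  proof (rule ex_ex1I)
    show "\<exists>\<delta>. is_inverse G \<gamma> \<delta>"
      using ex_inverse assms .
  next
    fix \<delta> \<epsilon>
    assume d: "is_inverse G \<gamma> \<delta>" and e: "is_inverse G \<gamma> \<epsilon>"
    have "\<delta> = mul G \<delta> (mul G \<gamma> \<epsilon>)"
      using d e src_unit[of \<delta>] by (simp add: is_inverse_def)
    also have "\<dots> = mul G (mul G \<delta> \<gamma>) \<epsilon>"
      using d e assms mul_assoc[of \<delta> \<gamma> \<epsilon>] by (simp add: is_inverse_def)
    also have "\<dots> = \<epsilon>"
      using d e rng_unit[of \<epsilon>] by (simp add: is_inverse_def)
    finally show "\<delta> = \<epsilon>" .
  qed
  then show ?thesis
    unfolding ginv_def by (rule theI')
qed

lemma (in groupoid)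
  assumes "\<gamma> \<in> arr G"
  shows src_eq: "src G \<gamma> = mul G (ginv G \<gamma>) \<gamma>"
    and rng_eq: "rng G \<gamma> = mul G \<gamma> (ginv G \<gamma>)"
  using is_inverse_ginv[OF assms] by (simp_all add: is_inverse_def)

definition units :: "'a category_data \<Rightarrow> 'a set" where
  "units G = src G ` arr G"

definition composable :: "'a category_data \<Rightarrow> ('a \<times> 'a) set" where
  "composable G = {(\<alpha>, \<beta>). \<alpha> \<in> arr G \<and> \<beta> \<in> arr G \<and> src G \<alpha> = rng G \<beta>}"

definition set_mul :: "'a category_data \<Rightarrow> 'a set \<Rightarrow> 'a set \<Rightarrow> 'a set" where
  "set_mul G A B = {mul G \<alpha> \<beta> |\<alpha> \<beta>. \<alpha> \<in> A \<and> \<beta> \<in> B \<and> src G \<alpha> = rng G \<beta>}"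

lemma (in groupoid) set_mul_units:
  assumes "V \<subseteq> units G" "K \<subseteq> arr G"
  shows "set_mul G (set_mul G V K) V = {\<gamma> \<in> K. rng G \<gamma> \<in> V \<and> src G \<gamma> \<in> V}"
proof -
  have u: "src G v = v" "rng G v = v" if "v \<in> V" for v
    using that assms(1) src_src rng_src by (auto simp: units_def)
  have 1: "set_mul G V K = {\<gamma> \<in> K. rng G \<gamma> \<in> V}"
    using u assms(2) rng_unit unfolding set_mul_def
    by (auto 0 3) (metis subsetD)
  show ?thesis
    unfolding 1 using u assms(2) src_unit unfolding set_mul_def
    by (auto 0 3) (metis subsetD)+
qed

definition Iso :: "'a category_data \<Rightarrow> 'a set" where
  "Iso G = {\<gamma> \<in> arr G. rng G \<gamma> = src G \<gamma>}"

definition local_homeomorphism :: "'a topology \<Rightarrow> 'b topology \<Rightarrow> ('a \<Rightarrow> 'b) \<Rightarrow> bool" where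
  "local_homeomorphism X Y f \<longleftrightarrow>
     (\<forall>x \<in> topspace X. \<exists>U. openin X U \<and> x \<in> U \<and> openin Y (f ` U) \<and>
        homeomorphic_map (subtopology X U) (subtopology Y (f ` U)) f)"

locale topological_groupoid = groupoid +
  fixes T :: "'a topology"
  assumes topspace_eq: "topspace T = arr G"
    and continuous_mul:
      "continuous_map (subtopology (prod_topology T T) (composable G)) T (\<lambda>(\<alpha>, \<beta>). mul G \<alpha> \<beta>)"
    and continuous_ginv: "continuous_map T T (ginv G)"

abbreviation unit_space :: "'a category_data \<Rightarrow> 'a topology \<Rightarrow> 'a topology" where
  "unit_space G T \<equiv> subtopology T (units G)"

locale etale_groupoid = topological_groupoid +
  assumes local_homeomorphism_rng: "local_homeomorphism T (unit_space G T) (rng G)"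

definition topologically_free :: "'a category_data \<Rightarrow> 'a topology \<Rightarrow> bool" where
  "topologically_free G T \<longleftrightarrow> T interior_of (Iso G - units G) = {}"

end

theory Submission
  imports Defs
begin

text \<open>
  The unit space is open, so removing it from a compact neighbourhood of a point of
  \<open>Int (Iso G - G\<^sup>0)\<close> leaves a compact set \<open>K\<close> that violates (1).

  For the converse, cover \<open>K\<close> by finitely many open sets \<open>B\<close> on which \<open>r\<close> is injective and shrink
  \<open>U\<close> once for each of them. If some \<open>\<gamma> \<in> UBU\<close> has \<open>r \<gamma> \<noteq> s \<gamma>\<close>, separate these two units. Otherwise
  \<open>UBU\<close> is an open subset of \<open>Iso G\<close>, so by topological freeness it is empty or meets the
  units; and an element of \<open>B\<close> whose range lies in \<open>B\<close> equals its range by injectivity of \<open>r\<close>, so it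
  is a unit.
\<close>

section \<open>Local homeomorphisms: injective charts, continuity, openness\<close>

lemma local_homeomorphism_open_inj:
  assumes "local_homeomorphism X Y f" "x \<in> topspace X"
  obtains U where "openin X U" "x \<in> U" "inj_on f U" "openin Y (f ` U)"
    "homeomorphic_map (subtopology X U) (subtopology Y (f ` U)) f"
proof -
  obtain U where U: "openin X U" "x \<in> U" "openin Y (f ` U)"
    and h: "homeomorphic_map (subtopology X U) (subtopology Y (f ` U)) f"
    using assms unfolding local_homeomorphism_def by blast
  have "topspace (subtopology X U) = U"
    using openin_subset[OF U(1)] by auto
  then have "inj_on f U"
    using homeomorphic_imp_injective_map[OF h] by simp
  with U h show thesis using that by blast
qed

lemma local_homeomorphism_imp_continuous_map:
  assumes "local_homeomorphism X Y f"
  shows "continuous_map X Y f"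
proof -
  have "\<exists>U. openin X U \<and> x \<in> U \<and> continuous_map (subtopology X U) Y f"
    if x: "x \<in> topspace X" for x
  proof -
    obtain U where U: "openin X U" "x \<in> U"
      "homeomorphic_map (subtopology X U) (subtopology Y (f ` U)) f"
      using local_homeomorphism_open_inj[OF assms x] by metis
    have "continuous_map (subtopology X U) Y f"
      using homeomorphic_imp_continuous_map[OF U(3)] continuous_map_in_subtopology by blast
    with U show ?thesis by blast
  qed
  note local = this
  \<comment> \<open>Gluing: the index set consists of all open sets on which \<open>f\<close> is
    continuous, each indexing itself with the same map \<open>f\<close>; \<open>local\<close> says
    that they cover the space.\<close>
  show ?thesis
    by (rule pasting_lemma[where I = "{U. openin X U \<and> continuous_map (subtopology X U) Y f}"
          and T = "\<lambda>U. U" and f = "\<lambda>_. f"]) (use local in auto)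
qed

lemma local_homeomorphism_imp_open_map:
  assumes "local_homeomorphism X Y f"
  shows "open_map X Y f"
  unfolding open_map_def
proof (intro allI impI)
  fix W assume W: "openin X W"
  show "openin Y (f ` W)"
  proof (subst openin_subopen, intro ballI)
    fix y assume "y \<in> f ` W"
    then obtain x where x: "x \<in> W" "y = f x" by blast
    then have "x \<in> topspace X" using openin_subset[OF W] by blast
    then obtain U where U: "openin X U" "x \<in> U" "openin Y (f ` U)"
      "homeomorphic_map (subtopology X U) (subtopology Y (f ` U)) f"
      using local_homeomorphism_open_inj[OF assms] by metis
    have "openin (subtopology X U) (W \<inter> U)"
      using W by (auto simp: openin_subtopology)
    then have "openin (subtopology Y (f ` U)) (f ` (W \<inter> U))"
      using homeomorphic_imp_open_map[OF U(4)] by (simp add: open_map_def)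
    then have "openin Y (f ` (W \<inter> U))"
      using U(3) openin_open_subtopology by blast
    then show "\<exists>T. openin Y T \<and> y \<in> T \<and> T \<subseteq> f ` W"
      using x U(2) by blast
  qed
qed

section \<open>Units, source and range in an etale groupoid\<close>

context small_category
begin

lemma unitsD:
  assumes "u \<in> units G"
  shows "u \<in> arr G" "src G u = u" "rng G u = u"
  using assms src_closed src_src rng_src by (auto simp: units_def)

lemma src_in_units: "\<gamma> \<in> arr G \<Longrightarrow> src G \<gamma> \<in> units G"
  by (simp add: units_def)

lemma rng_in_units: "\<gamma> \<in> arr G \<Longrightarrow> rng G \<gamma> \<in> units G"
  unfolding units_def by (metis image_eqI rng_closed src_rng)

end

context etale_groupoid
begin

lemma continuous_rng: "continuous_map T T (rng G)"
  using local_homeomorphism_imp_continuous_map[OF local_homeomorphism_rng]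
  by (simp add: continuous_map_in_subtopology)

text \<open>Etaleness is stated for the range map; inversion carries continuity over to the source
  map.\<close>

lemma continuous_src: "continuous_map T T (src G)"
proof (rule continuous_map_eq)
  show "continuous_map T T (rng G \<circ> ginv G)"
    using continuous_ginv continuous_rng by (rule continuous_map_compose)
  show "(rng G \<circ> ginv G) \<gamma> = src G \<gamma>" if "\<gamma> \<in> topspace T" for \<gamma>
    using is_inverse_ginv that by (simp add: topspace_eq is_inverse_def)
qed

text \<open>For \<open>V\<close> and \<open>W\<close> consisting of units this set is the product
  \<open>VBW\<close>. Allowing arbitrary open sets lets \<open>B\<close> itself serve as a
  constraint on ranges.\<close>

lemma open_preimages:
  assumes "openin T B" "openin T V" "openin T W"
  shows "openin T {\<gamma> \<in> B. rng G \<gamma> \<in> V \<and> src G \<gamma> \<in> W}"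
proof -
  have "openin T (B \<inter> {\<gamma> \<in> topspace T. rng G \<gamma> \<in> V} \<inter> {\<gamma> \<in> topspace T. src G \<gamma> \<in> W})"
    using assms continuous_rng continuous_src
    by (intro openin_Int openin_continuous_map_preimage)
  also have "B \<inter> {\<gamma> \<in> topspace T. rng G \<gamma> \<in> V} \<inter> {\<gamma> \<in> topspace T. src G \<gamma> \<in> W}
      = {\<gamma> \<in> B. rng G \<gamma> \<in> V \<and> src G \<gamma> \<in> W}"
    using openin_subset[OF assms(1)] by auto
  finally show ?thesis .
qed

lemma rng_inj_nbhd:
  assumes "\<gamma> \<in> arr G"
  obtains B where "openin T B" "\<gamma> \<in> B" "inj_on (rng G) B"
  using local_homeomorphism_open_inj[OF local_homeomorphism_rng] assms
  by (metis topspace_eq)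

lemma openin_units: "openin T (units G)"
proof (subst openin_subopen, intro ballI)
  fix u assume u: "u \<in> units G"
  then obtain B where B: "openin T B" "u \<in> B" "inj_on (rng G) B"
    using rng_inj_nbhd unitsD(1) by metis
  have BG: "B \<subseteq> arr G" using openin_subset[OF B(1)] by (simp add: topspace_eq)
  \<comment> \<open>Taking \<open>topspace T\<close> makes the source condition vacuous:
    \<open>?C\<close> collects the elements of \<open>B\<close> whose range is again in
    \<open>B\<close>.\<close>
  let ?C = "{\<gamma> \<in> B. rng G \<gamma> \<in> B \<and> src G \<gamma> \<in> topspace T}"
  have "\<gamma> \<in> units G" if "\<gamma> \<in> ?C" for \<gamma>
  proof -
    \<comment> \<open>Both \<open>\<gamma>\<close> and \<open>rng G \<gamma>\<close> lie in
      \<open>B\<close>, and they have the same range.\<close>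
    have "rng G \<gamma> = \<gamma>"
      by (rule inj_onD[OF B(3)]) (use that BG rng_rng in auto)
    then show ?thesis using that BG rng_in_units[of \<gamma>] by auto
  qed
  moreover have "openin T ?C" using B by (intro open_preimages) auto
  moreover have "u \<in> ?C" using B u unitsD[OF u] by (simp add: topspace_eq)
  ultimately show "\<exists>C. openin T C \<and> u \<in> C \<and> C \<subseteq> units G" by blast
qed

lemma openin_unit_space: "openin (unit_space G T) V \<longleftrightarrow> openin T V \<and> V \<subseteq> units G"
  using openin_units by (rule openin_open_subtopology)

lemma openin_rng_image:
  assumes "openin T B"
  shows "openin (unit_space G T) (rng G ` B)"
  using local_homeomorphism_imp_open_map[OF local_homeomorphism_rng] assms
  by (simp add: open_map_def)

section \<open>From avoidance of compact sets to topological freeness\<close>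

lemma avoiding_imp_topologically_free:
  assumes lc: "locally_compact_space T"
    and avoid: "\<And>U K. \<lbrakk>openin (unit_space G T) U; U \<noteq> {}; compactin T K; K \<subseteq> arr G - units G\<rbrakk>
      \<Longrightarrow> \<exists>V. openin (unit_space G T) V \<and> V \<noteq> {} \<and> V \<subseteq> U \<and>
            set_mul G (set_mul G V K) V = {}"
  shows "topologically_free G T"
  unfolding topologically_free_def
proof (rule ccontr)
  let ?I = "T interior_of (Iso G - units G)"
  assume "?I \<noteq> {}"
  then obtain \<gamma> where \<gamma>: "\<gamma> \<in> ?I" by blast
  then have "\<gamma> \<in> topspace T" using interior_of_subset_topspace by (metis subsetD)
  then obtain N C where N: "openin T N" "compactin T C" "\<gamma> \<in> N" "N \<subseteq> C"
    using lc unfolding locally_compact_space_def by blast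
  define K where "K = C - units G"
  \<comment> \<open>A compact set meets a closed set in a compact set, even when \<open>T\<close> is
    not Hausdorff and \<open>C\<close> is not closed.\<close>
  have "K = C \<inter> (topspace T - units G)"
    using compactin_subset_topspace[OF N(2)] by (auto simp: K_def)
  then have K: "compactin T K"
    using N(2) openin_units by (metis closedin_diff closedin_topspace compact_Int_closedin)
  have KG: "K \<subseteq> arr G - units G"
    using compactin_subset_topspace[OF N(2)] by (auto simp: K_def topspace_eq)
  \<comment> \<open>This image is the set \<open>U\<close> fed to (1): every unit in it is the range
    of some element of \<open>?I\<close> lying in \<open>K\<close>.\<close>
  have "openin (unit_space G T) (rng G ` (?I \<inter> N))"
    using N(1) by (intro openin_rng_image openin_Int) auto
  moreover have "rng G ` (?I \<inter> N) \<noteq> {}" using \<gamma> N by blast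
  ultimately obtain V where V: "openin (unit_space G T) V" "V \<noteq> {}"
      "V \<subseteq> rng G ` (?I \<inter> N)" "set_mul G (set_mul G V K) V = {}"
    using avoid K KG by meson
  then obtain \<beta> where \<beta>: "\<beta> \<in> ?I" "\<beta> \<in> N" "rng G \<beta> \<in> V" by blast
  \<comment> \<open>Isotropy forces the source of \<open>\<beta>\<close> into \<open>V\<close> along
    with its range, so \<open>\<beta>\<close> witnesses that \<open>VKV\<close> is
    non-empty.\<close>
  have "\<beta> \<in> Iso G - units G" using \<beta>(1) interior_of_subset by (metis subsetD)
  then have "\<beta> \<in> {\<gamma> \<in> K. rng G \<gamma> \<in> V \<and> src G \<gamma> \<in> V}"
    using \<beta> N by (auto simp: Iso_def K_def)
  also have "\<dots> = set_mul G (set_mul G V K) V"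
    using V(1) KG by (intro set_mul_units[symmetric]) (auto simp: openin_unit_space)
  finally show False using V(4) by simp
qed

section \<open>From topological freeness to avoidance, for a Hausdorff unit space\<close>

lemma shrink_to_avoid_bisection:
  assumes haus: "Hausdorff_space (unit_space G T)"
    and free: "topologically_free G T"
    and W: "openin (unit_space G T) W" "W \<noteq> {}"
    and B: "openin T B" "inj_on (rng G) B"
  shows "\<exists>V. openin (unit_space G T) V \<and> V \<noteq> {} \<and> V \<subseteq> W \<and>
    (\<forall>\<gamma> \<in> B - units G. rng G \<gamma> \<in> V \<longrightarrow> src G \<gamma> \<notin> V)"
proof -
  have BG: "B \<subseteq> arr G" using openin_subset[OF B(1)] by (simp add: topspace_eq)
  have W': "openin T W" using W by (simp add: openin_unit_space)
  \<comment> \<open>\<open>F\<close> is \<open>WBW\<close>, the obstruction to using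
    \<open>W\<close> itself.\<close>
  define F where "F = {\<gamma> \<in> B. rng G \<gamma> \<in> W \<and> src G \<gamma> \<in> W}"
  have F: "openin T F" unfolding F_def using B W' by (intro open_preimages)
  consider "F = {}" | \<gamma> where "\<gamma> \<in> F" "rng G \<gamma> \<noteq> src G \<gamma>" | "F \<noteq> {}" "F \<subseteq> Iso G"
    using BG by (auto simp: F_def Iso_def)
  then show ?thesis
  proof cases
    case 1
    then show ?thesis using W by (intro exI[of _ W]) (auto simp: F_def)
  next
    case 2
    then have "\<gamma> \<in> arr G" using BG by (auto simp: F_def)
    then have "rng G \<gamma> \<in> topspace (unit_space G T)" "src G \<gamma> \<in> topspace (unit_space G T)"
      using rng_in_units src_in_units rng_closed src_closed by (auto simp: topspace_eq)
    then obtain P Q where PQ: "openin (unit_space G T) P" "openin (unit_space G T) Q"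
        "rng G \<gamma> \<in> P" "src G \<gamma> \<in> Q" "disjnt P Q"
      using haus 2(2) unfolding Hausdorff_space_def by meson
    \<comment> \<open>\<open>E\<close> is an open neighbourhood of \<open>\<gamma>\<close> in
      \<open>F\<close> whose ranges and sources lie in disjoint sets; the new \<open>V\<close> is
      its image under the range map.\<close>
    define E where "E = {\<beta> \<in> F. rng G \<beta> \<in> P \<and> src G \<beta> \<in> Q}"
    have "openin T E"
      unfolding E_def using F PQ by (intro open_preimages) (auto simp: openin_unit_space)
    then have "openin (unit_space G T) (rng G ` E)" by (rule openin_rng_image)
    moreover have "\<gamma> \<in> E" using 2 PQ by (simp add: E_def)
    moreover have "rng G ` E \<subseteq> W" by (auto simp: E_def F_def)
    \<comment> \<open>Injectivity on \<open>B\<close> puts \<open>\<beta>\<close> in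
      \<open>E\<close>, so its source is in \<open>Q\<close>, whereas all ranges of \<open>E\<close>
      are in \<open>P\<close>.\<close>
    moreover have "src G \<beta> \<notin> rng G ` E" if "\<beta> \<in> B" "rng G \<beta> \<in> rng G ` E" for \<beta>
    proof -
      have "\<beta> \<in> E"
        using that B(2) by (auto simp: E_def F_def inj_on_eq_iff)
      then show ?thesis using PQ(5) by (auto simp: E_def disjnt_iff)
    qed
    ultimately show ?thesis by (intro exI[of _ "rng G ` E"]) auto
  next
    case 3
    have "F \<inter> units G \<noteq> {}"
    proof
      assume "F \<inter> units G = {}"
      then have "F \<subseteq> T interior_of (Iso G - units G)"
        using 3 F by (intro interior_of_maximal) auto
      then show False using free 3 by (simp add: topologically_free_def)
    qed
    moreover have "openin (unit_space G T) (F \<inter> units G)"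
      using F openin_units by (simp add: openin_unit_space openin_Int)
    moreover have "F \<inter> units G \<subseteq> W" using unitsD by (auto simp: F_def)
    \<comment> \<open>With \<open>V\<close> chosen as \<open>F \<inter> units G\<close>, a subset of
      \<open>B\<close>, an element of \<open>B\<close> with range in \<open>V\<close> is its own
      range; thus no non-unit of \<open>B\<close> has its range in \<open>V\<close>.\<close>
    moreover have "\<gamma> \<in> units G" if "\<gamma> \<in> B" "rng G \<gamma> \<in> F \<inter> units G" for \<gamma>
    proof -
      have "rng G \<gamma> = \<gamma>"
        by (rule inj_onD[OF B(2)]) (use that BG rng_rng in \<open>auto simp: F_def\<close>)
      then show ?thesis using that by simp
    qed
    ultimately show ?thesis by (intro exI[of _ "F \<inter> units G"]) auto
  qed
qed

text \<open>The avoidance property is inherited by subsets of \<open>V\<close>, so shrinking for one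
  member of the family preserves what was achieved for the others, and induction applies.\<close>

lemma shrink_to_avoid_bisections:
  assumes "Hausdorff_space (unit_space G T)" "topologically_free G T"
    and "finite \<B>" "\<And>B. B \<in> \<B> \<Longrightarrow> openin T B \<and> inj_on (rng G) B"
    and "openin (unit_space G T) U" "U \<noteq> {}"
  shows "\<exists>V. openin (unit_space G T) V \<and> V \<noteq> {} \<and> V \<subseteq> U \<and>
    (\<forall>\<gamma> \<in> \<Union>\<B> - units G. rng G \<gamma> \<in> V \<longrightarrow> src G \<gamma> \<notin> V)"
  using assms(3,4)
proof (induction \<B>)
  case empty
  then show ?case using assms(5,6) by auto
next
  case (insert B \<B>)
  then obtain W where W: "openin (unit_space G T) W" "W \<noteq> {}" "W \<subseteq> U"
      "\<forall>\<gamma> \<in> \<Union>\<B> - units G. rng G \<gamma> \<in> W \<longrightarrow> src G \<gamma> \<notin> W"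
    by (metis insertI2)
  obtain V where V: "openin (unit_space G T) V" "V \<noteq> {}" "V \<subseteq> W"
      "\<forall>\<gamma> \<in> B - units G. rng G \<gamma> \<in> V \<longrightarrow> src G \<gamma> \<notin> V"
    using shrink_to_avoid_bisection[OF assms(1,2) W(1,2), of B] insert.prems by blast
  have "\<forall>\<gamma> \<in> \<Union>(insert B \<B>) - units G. rng G \<gamma> \<in> V \<longrightarrow> src G \<gamma> \<notin> V"
    using V(3,4) W(4) by blast
  with V W(3) show ?case by blast
qed

lemma topologically_free_imp_avoiding:
  assumes haus: "Hausdorff_space (unit_space G T)" and free: "topologically_free G T"
    and U: "openin (unit_space G T) U" "U \<noteq> {}"
    and K: "compactin T K" "K \<subseteq> arr G - units G"
  shows "\<exists>V. openin (unit_space G T) V \<and> V \<noteq> {} \<and> V \<subseteq> U \<and> set_mul G (set_mul G V K) V = {}"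
proof -
  \<comment> \<open>All open sets on which the range map is injective; compactness of
    \<open>K\<close> selects finitely many of them.\<close>
  let ?\<C> = "{B. openin T B \<and> inj_on (rng G) B}"
  have "K \<subseteq> \<Union>?\<C>"
  proof
    fix \<gamma> assume "\<gamma> \<in> K"
    then obtain B where "openin T B" "\<gamma> \<in> B" "inj_on (rng G) B"
      using K(2) rng_inj_nbhd[of \<gamma>] by blast
    then show "\<gamma> \<in> \<Union>?\<C>" by blast
  qed
  then obtain \<B> where \<B>: "finite \<B>" "\<B> \<subseteq> ?\<C>" "K \<subseteq> \<Union>\<B>"
    using compactinD[OF K(1), of ?\<C>] by auto
  then obtain V where V: "openin (unit_space G T) V" "V \<noteq> {}" "V \<subseteq> U"
      "\<forall>\<gamma> \<in> \<Union>\<B> - units G. rng G \<gamma> \<in> V \<longrightarrow> src G \<gamma> \<notin> V"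
    using shrink_to_avoid_bisections[OF haus free \<B>(1) _ U] by blast
  have "set_mul G (set_mul G V K) V = {\<gamma> \<in> K. rng G \<gamma> \<in> V \<and> src G \<gamma> \<in> V}"
    using V(1) K(2) by (intro set_mul_units) (auto simp: openin_unit_space)
  also have "\<dots> = {}" using V(4) K(2) \<B>(3) by blast
  finally show ?thesis using V by blast
qed

end

theorem proposition4p1:
  fixes G :: "'a category_data" and T :: "'a topology"
  assumes "etale_groupoid G T"
    and "locally_compact_space T"
  shows "let cond1 = (\<forall>U K. openin (unit_space G T) U \<and> U \<noteq> {} \<and>
                        compactin T K \<and> K \<subseteq> arr G - units G \<longrightarrow>
                        (\<exists>V. openin (unit_space G T) V \<and> V \<noteq> {} \<and> V \<subseteq> U \<and>
                             set_mul G (set_mul G V K) V = {}));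
             cond2 = topologically_free G T
         in (cond1 \<longrightarrow> cond2) \<and>
            (Hausdorff_space (unit_space G T) \<longrightarrow> (cond1 \<longleftrightarrow> cond2))"
proof -
  interpret etale_groupoid G T by (rule assms(1))
  show ?thesis
    unfolding Let_def
    using avoiding_imp_topologically_free[OF assms(2)] topologically_free_imp_avoiding by meson
qed

end
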